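(* Let $0\le\nu_1<\nu_2\le1$, $k\in\mathbb{N}$, $\delta\in[0,1]$, $\gamma\ge1$, $\Delta\ge0$, $D\in\mathbb{N}$, and suppose $d \le n/2$ and $\nu_2 n \le k$. Suppose that with probability at least $1-\Delta$ when $Y,Y' \sim G(n,d/n)$ independently, $\mathcal{F}(Y,Y')$ has the $(k,\nu_1,\nu_2)$-overlap gap property on $\{0,1\}^n$ with overlap $R(x_1,x_2)=|\langle x_1,x_2\rangle|/n$, and $F(\cdot\,;Y)$ and $F(\cdot\,;Y')$ are $\nu_1$-separated above $k$ with respect to $R$. If \[ \Delta + 3\delta(m+1) < \exp\left(-\frac{96 \gamma D k \log(n/d)}{(\nu_2 - \nu_1)^2 n}\right), \] then for any $\eta \le \frac{1}{4}(\nu_2 - \nu_1)^2$ (with $\eta>0$), there is no random degree-$D$ polynomial that $(k,\delta,\gamma,\eta)$-optimizes the maximum independent set problem for $Y\sim G(n,d/n)$.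
   Context: $m=\binom n2$; graphs on $[n]$ are identified with adjacency vectors in $\{0,1\}^m$ (coordinates in a fixed order); $G(n,d/n)$ is the Erdős–Rényi graph with edge probability $d/n$. For $x\in\{0,1\}^n$, $S(x)=\{i:x_i=1\}$ and $F(x;Y)=|S(x)|\cdot\mathbf{1}\{S(x)\text{ is an independent set in } Y\}$. The path from $Y$ to $Y'$ is $Z_0=Y\to Z_1\to\cdots\to Z_m=Y'$ with $(Z_i)_j=Y_j$ for $j>i$ and $(Z_i)_j=Y'_j$ for $j\le i$; $\mathcal{F}(Y,Y')=\{F(\cdot\,;Z):Z \text{ on this path}\}$. A family $\mathcal{F}$ on domain $\mathcal{X}$ has the $(\mu,\nu_1,\nu_2)$-overlap gap property for $R$ if $f_1(x_1)\ge\mu$, $f_2(x_2)\ge\mu$ with $f_1,f_2\in\mathcal{F}$ imply $R(x_1,x_2)\in[0,\nu_1]\cup[\nu_2,1]$; $f,g$ are $\nu$-separated above $\mu$ if $f(x)\ge\mu$, $g(y)\ge\mu$ imply $R(x,y)\le\nu$. A random degree-$D$ polynomial is $f:\{0,1\}^m\times\Omega\to\mathbb{R}^n$, $(\Omega,\mathbb{P}_\omega)$ independent of $Y$, with each coordinate of $f(\cdot,\omega)$ a real polynomial of degree at most $D$. For $\eta>0$: $A=\{i:f_i(Y,\omega)\ge1\}$, $\tilde A=\{i\in A: i\text{ has no neighbor in } A\}$, $B=\{i: f_i(Y,\omega)\in(1/2,1)\}$, and $V_f^\eta(Y,\omega)=\tilde A$ if $|A\setminus\tilde A|+|B|\le\eta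 n$, else $\emptyset$. $f$ $(k,\delta,\gamma,\eta)$-optimizes the problem if $\mathbb{E}_{Y,\omega}\|f(Y,\omega)\|_2^2\le\gamma k$ and, with probability at least $1-\delta$ over $(Y,\omega)\sim G(n,d/n)\otimes\mathbb{P}_\omega$, $|V_f^\eta(Y,\omega)|\ge k$. *)

theory Defs
  imports "HOL-Probability.Probability"
begin

text \<open>The cube \<open>{0,1}^N\<close>: Boolean sequences that are False from position \<open>N\<close> on. Vertices and
  coordinates are numbered from 0, so \<open>[n]\<close> is \<open>{..<n}\<close>.\<close>

definition cube :: "nat \<Rightarrow> (nat \<Rightarrow> bool) set" where
  "cube N = {x. \<forall>i\<ge>N. \<not> x i}"

definition edge_order :: "nat \<Rightarrow> (nat \<Rightarrow> nat set) \<Rightarrow> bool" where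
  "edge_order n e \<longleftrightarrow> bij_betw e {..<n choose 2} {E. E \<subseteq> {..<n} \<and> card E = 2}"

definition adjacent :: "nat \<Rightarrow> (nat \<Rightarrow> nat set) \<Rightarrow> (nat \<Rightarrow> bool) \<Rightarrow> nat \<Rightarrow> nat \<Rightarrow> bool" where
  "adjacent n e Y u v \<longleftrightarrow> (\<exists>j < n choose 2. e j = {u, v} \<and> Y j)"

definition independent_in :: "nat \<Rightarrow> (nat \<Rightarrow> nat set) \<Rightarrow> (nat \<Rightarrow> bool) \<Rightarrow> nat set \<Rightarrow> bool" where
  "independent_in n e Y S \<longleftrightarrow> (\<forall>u\<in>S. \<forall>v\<in>S. \<not> adjacent n e Y u v)"

definition er_graph :: "nat \<Rightarrow> real \<Rightarrow> (nat \<Rightarrow> bool) pmf" where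
  "er_graph n p = Pi_pmf {..<n choose 2} False (\<lambda>_. bernoulli_pmf p)"

definition vsupp :: "nat \<Rightarrow> (nat \<Rightarrow> bool) \<Rightarrow> nat set" where
  "vsupp n x = {i. i < n \<and> x i}"

definition indep_obj ::
  "nat \<Rightarrow> (nat \<Rightarrow> nat set) \<Rightarrow> (nat \<Rightarrow> bool) \<Rightarrow> (nat \<Rightarrow> bool) \<Rightarrow> real" where
  "indep_obj n e Y x = real (card (vsupp n x)) * of_bool (independent_in n e Y (vsupp n x))"

definition overlap :: "nat \<Rightarrow> (nat \<Rightarrow> bool) \<Rightarrow> (nat \<Rightarrow> bool) \<Rightarrow> real" where
  "overlap n x1 x2 = \<bar>\<Sum>i<n. of_bool (x1 i) * of_bool (x2 i)\<bar> / real n"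

text \<open>Because coordinates start at 0, the coordinates \<open>j \<le> i\<close> of the usual 1-based numbering
  are those with \<open>j < i\<close> here.\<close>

definition path_point :: "(nat \<Rightarrow> bool) \<Rightarrow> (nat \<Rightarrow> bool) \<Rightarrow> nat \<Rightarrow> nat \<Rightarrow> bool" where
  "path_point Y Y' i = (\<lambda>j. if j < i then Y' j else Y j)"

definition path_family ::
  "nat \<Rightarrow> (nat \<Rightarrow> nat set) \<Rightarrow> (nat \<Rightarrow> bool) \<Rightarrow> (nat \<Rightarrow> bool) \<Rightarrow> ((nat \<Rightarrow> bool) \<Rightarrow> real) set" where
  "path_family n e Y Y' = (\<lambda>i. indep_obj n e (path_point Y Y' i)) ` {..n choose 2}"

definition overlap_gap ::
  "'x set \<Rightarrow> ('x \<Rightarrow> 'x \<Rightarrow> real) \<Rightarrow> real \<Rightarrow> real \<Rightarrow> real \<Rightarrow> ('x \<Rightarrow> real) set \<Rightarrow> bool" where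
  "overlap_gap X R \<mu> \<nu>1 \<nu>2 \<F> \<longleftrightarrow>
     (\<forall>f1\<in>\<F>. \<forall>f2\<in>\<F>. \<forall>x1\<in>X. \<forall>x2\<in>X.
        f1 x1 \<ge> \<mu> \<and> f2 x2 \<ge> \<mu> \<longrightarrow> R x1 x2 \<in> {0..\<nu>1} \<union> {\<nu>2..1})"

definition separated_above ::
  "'x set \<Rightarrow> ('x \<Rightarrow> 'x \<Rightarrow> real) \<Rightarrow> real \<Rightarrow> real \<Rightarrow> ('x \<Rightarrow> real) \<Rightarrow> ('x \<Rightarrow> real) \<Rightarrow> bool" where
  "separated_above X R \<nu> \<mu> f g \<longleftrightarrow>
     (\<forall>x\<in>X. \<forall>y\<in>X. f x \<ge> \<mu> \<and> g y \<ge> \<mu> \<longrightarrow> R x y \<le> \<nu>)"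

text \<open>Exponent vectors of the monomials of total degree at most \<open>D\<close> in \<open>N\<close> variables.\<close>

definition exponents :: "nat \<Rightarrow> nat \<Rightarrow> (nat \<Rightarrow> nat) set" where
  "exponents N D = {\<alpha>. (\<forall>j\<ge>N. \<alpha> j = 0) \<and> (\<Sum>j<N. \<alpha> j) \<le> D}"

lemma finite_exponents: "finite (exponents N D)"
proof (rule finite_subset)
  show "exponents N D \<subseteq> {\<alpha>. \<forall>j. (j \<in> {..<N} \<longrightarrow> \<alpha> j \<in> {..D}) \<and> (j \<notin> {..<N} \<longrightarrow> \<alpha> j = 0)}"
  proof
    fix \<alpha> assume "\<alpha> \<in> exponents N D"
    then have z: "\<forall>j\<ge>N. \<alpha> j = 0" and s: "(\<Sum>j<N. \<alpha> j) \<le> D"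
      by (auto simp: exponents_def)
    have "\<alpha> j \<le> D" if "j < N" for j
      using member_le_sum[of j "{..<N}" \<alpha>] that s by simp
    with z show "\<alpha> \<in> {\<alpha>. \<forall>j. (j \<in> {..<N} \<longrightarrow> \<alpha> j \<in> {..D}) \<and> (j \<notin> {..<N} \<longrightarrow> \<alpha> j = 0)}"
      by auto
  qed
  show "finite {\<alpha>. \<forall>j. (j \<in> {..<N} \<longrightarrow> \<alpha> j \<in> {..D}) \<and> (j \<notin> {..<N} \<longrightarrow> \<alpha> j = (0::nat))}"
    by (rule finite_set_of_finite_funs) auto
qed

definition poly_deg_le :: "nat \<Rightarrow> nat \<Rightarrow> ((nat \<Rightarrow> bool) \<Rightarrow> real) \<Rightarrow> bool" where
  "poly_deg_le N D g \<longleftrightarrow>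
     (\<exists>c. \<forall>y\<in>cube N. g y = (\<Sum>\<alpha>\<in>exponents N D. c \<alpha> * (\<Prod>j<N. of_bool (y j) ^ \<alpha> j)))"

text \<open>Only the values \<open>f y \<omega> i\<close> with \<open>y\<close> in the cube and \<open>i < n\<close> carry meaning. Joint
  measurability is what makes the expectation and the probability below well defined. It restricts
  nothing else: any \<open>f\<close> on the cube that is measurable in \<open>\<omega>\<close> extends by 0 to such a function.\<close>

definition random_poly ::
  "nat \<Rightarrow> nat \<Rightarrow> 'w measure \<Rightarrow> ((nat \<Rightarrow> bool) \<Rightarrow> 'w \<Rightarrow> nat \<Rightarrow> real) \<Rightarrow> bool" where
  "random_poly n D M f \<longleftrightarrow>
     prob_space M \<and>
     (\<forall>i<n. (\<lambda>(y, \<omega>). f y \<omega> i) \<in> borel_measurable (count_space UNIV \<Otimes>\<^sub>M M)) \<and>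
     (\<forall>i<n. \<forall>\<omega>\<in>space M. poly_deg_le (n choose 2) D (\<lambda>y. f y \<omega> i))"

definition set_A :: "nat \<Rightarrow> (nat \<Rightarrow> real) \<Rightarrow> nat set" where
  "set_A n v = {i. i < n \<and> v i \<ge> 1}"

definition set_A_tilde ::
  "nat \<Rightarrow> (nat \<Rightarrow> nat set) \<Rightarrow> (nat \<Rightarrow> bool) \<Rightarrow> (nat \<Rightarrow> real) \<Rightarrow> nat set" where
  "set_A_tilde n e Y v = {i \<in> set_A n v. \<forall>j\<in>set_A n v. \<not> adjacent n e Y i j}"

definition set_B :: "nat \<Rightarrow> (nat \<Rightarrow> real) \<Rightarrow> nat set" where
  "set_B n v = {i. i < n \<and> v i \<in> {1/2<..<1}}"

definition rounding ::
  "nat \<Rightarrow> (nat \<Rightarrow> nat set) \<Rightarrow> real \<Rightarrow> (nat \<Rightarrow> bool) \<Rightarrow> (nat \<Rightarrow> real) \<Rightarrow> nat set" where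
  "rounding n e \<eta> Y v =
     (if real (card (set_A n v - set_A_tilde n e Y v) + card (set_B n v)) \<le> \<eta> * real n
      then set_A_tilde n e Y v else {})"

text \<open>The expectation of the squared norm is taken in \<open>[0,\<infinity>]\<close>, so a non-integrable norm does not
  satisfy the bound.\<close>

definition optimizes ::
  "nat \<Rightarrow> (nat \<Rightarrow> nat set) \<Rightarrow> real \<Rightarrow> nat \<Rightarrow> real \<Rightarrow> real \<Rightarrow> real \<Rightarrow> 'w measure \<Rightarrow>
   ((nat \<Rightarrow> bool) \<Rightarrow> 'w \<Rightarrow> nat \<Rightarrow> real) \<Rightarrow> bool" where
  "optimizes n e d k \<delta> \<gamma> \<eta> M f \<longleftrightarrow>
     (let P = measure_pmf (er_graph n (d / real n)) \<Otimes>\<^sub>M M in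
       (\<integral>\<^sup>+ (Y, \<omega>). ennreal (\<Sum>i<n. (f Y \<omega> i)\<^sup>2) \<partial>P) \<le> ennreal (\<gamma> * real k) \<and>
       measure P {(Y, \<omega>) \<in> space P. card (rounding n e \<eta> Y (f Y \<omega>)) \<ge> k} \<ge> 1 - \<delta>)"

end

theory Submission
  imports Defs
begin

text \<open>By Markov's inequality some value of \<open>\<omega>\<close> makes \<open>f(\<cdot>, \<omega>)\<close> a deterministic polynomial with energy
  at most \<open>3 \<gamma> k\<close> and failure probability about \<open>3 \<delta>\<close>. Every path point has the law of \<open>Y\<close>, so by a
  union bound the rounded sets are large independent sets along the whole path, and the overlap gap
  forces two consecutive ones to differ in at least \<open>(\<nu>2 - \<nu>1) n\<close> vertices. This makes \<open>f\<close> jump by at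
  least \<open>(\<nu>2 - \<nu>1)\<^sup>2 n / 8\<close> in squared norm. On the other hand, degree \<open>D\<close> bounds the total influence of
  \<open>f\<close>, hence the total probability of those flips of one coordinate that produce such a jump. The
  probability that a path makes no such flip is estimated backwards in time with the concavity of
  \<open>ln\<close>: a bad flip of coordinate \<open>j\<close> is avoided if \<open>Y'\<close> agrees with the current bit there, which costs
  the entropy of one bit in the expected logarithm.\<close>

section \<open>Random bits and the interpolating path\<close>

lemma expectation_bind_finite:
  fixes h :: "'b \<Rightarrow> real"
  assumes "finite (set_pmf p)" and "\<And>x. x \<in> set_pmf p \<Longrightarrow> finite (set_pmf (f x))"
  shows "measure_pmf.expectation (bind_pmf p f) h =
    measure_pmf.expectation p (\<lambda>x. measure_pmf.expectation (f x) h)"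
  using assms
  by (subst pmf_expectation_bind[where A = "set_pmf p"]) (auto simp: integral_measure_pmf)

lemma expectation_pair_finite:
  fixes h :: "'a \<times> 'b \<Rightarrow> real"
  assumes "finite (set_pmf p)" and "finite (set_pmf q)"
  shows "measure_pmf.expectation (pair_pmf p q) h =
    measure_pmf.expectation p (\<lambda>x. measure_pmf.expectation q (\<lambda>y. h (x, y)))"
  unfolding pair_pmf_def using assms by (simp add: expectation_bind_finite)

definition random_bits :: "nat \<Rightarrow> real \<Rightarrow> (nat \<Rightarrow> bool) pmf" where
  "random_bits N p = Pi_pmf {..<N} False (\<lambda>_. bernoulli_pmf p)"

lemma set_random_bits: "set_pmf (random_bits N p) \<subseteq> cube N"
  unfolding random_bits_def cube_def
  using set_Pi_pmf_subset[of "{..<N}" False "\<lambda>_. bernoulli_pmf p"] by auto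

lemma finite_cube: "finite (cube N)"
proof (rule finite_subset)
  show "cube N \<subseteq> {f. \<forall>x. (x \<in> {..<N} \<longrightarrow> f x \<in> UNIV) \<and> (x \<notin> {..<N} \<longrightarrow> f x = False)}"
    by (auto simp: cube_def)
  show "finite {f. \<forall>x. (x \<in> {..<N} \<longrightarrow> f x \<in> (UNIV :: bool set)) \<and> (x \<notin> {..<N} \<longrightarrow> f x = False)}"
    by (rule finite_set_of_finite_funs) auto
qed

lemma finite_set_random_bits [simp]: "finite (set_pmf (random_bits N p))"
  using finite_subset[OF set_random_bits finite_cube] .

lemma integrable_random_bits [simp]:
  "integrable (measure_pmf (random_bits N p)) (h :: _ \<Rightarrow> real)"
  by (rule integrable_measure_pmf_finite) simp

text \<open>The bits are independent, so overwriting one of them with a fresh bit does not change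
  the law. All later uses of the product structure go through this one-bit conditioning.\<close>

lemma random_bits_resample:
  assumes "i < N"
  shows "random_bits N p =
    bind_pmf (bernoulli_pmf p) (\<lambda>b. map_pmf (\<lambda>y. y(i := b)) (random_bits N p))"
proof -
  let ?\<mu> = "\<lambda>A. Pi_pmf A False (\<lambda>_. bernoulli_pmf p)"
  have "?\<mu> {..<N} = ?\<mu> (insert i ({..<N} - {i}))"
    using assms by (simp add: insert_absorb)
  also have "\<dots> = bind_pmf (bernoulli_pmf p) (\<lambda>b. map_pmf (\<lambda>y. y(i := b)) (?\<mu> ({..<N} - {i})))"
    by (subst Pi_pmf_insert') (auto simp: map_pmf_def)
  also have "\<dots> = bind_pmf (bernoulli_pmf p) (\<lambda>b. map_pmf (\<lambda>y. y(i := b)) (?\<mu> {..<N}))"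
    by (subst Pi_pmf_remove) (auto simp: map_pmf_comp)
  finally show ?thesis
    by (simp add: random_bits_def)
qed

lemma expectation_resample:
  fixes h :: "(nat \<Rightarrow> bool) \<Rightarrow> real"
  assumes "i < N" and "0 \<le> p" "p \<le> 1"
  shows "measure_pmf.expectation (random_bits N p) h =
    p * measure_pmf.expectation (random_bits N p) (\<lambda>y. h (y(i := True))) +
    (1 - p) * measure_pmf.expectation (random_bits N p) (\<lambda>y. h (y(i := False)))"
  by (subst random_bits_resample[OF assms(1)]) (use assms in \<open>simp add: expectation_bind_finite\<close>)

lemma path_point_0 [simp]: "path_point Y Y' 0 = Y"
  by (simp add: path_point_def)

lemma path_point_Suc: "path_point Y Y' (Suc i) = (path_point Y Y' i)(i := Y' i)"
  by (auto simp: path_point_def fun_eq_iff)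

lemma path_point_full:
  assumes "Y \<in> cube N" "Y' \<in> cube N"
  shows "path_point Y Y' N = Y'"
  using assms by (auto simp: path_point_def cube_def fun_eq_iff)

text \<open>\<open>path_point Y Y' i\<close> reads \<open>Y'\<close> only below coordinate
  \<open>i\<close>, so the bit \<open>Y' i\<close> written by the next step is independent of it.
  Each step is therefore a resampling of one coordinate, which preserves the law.\<close>

lemma map_path_point:
  assumes "i \<le> N"
  shows "map_pmf (\<lambda>(Y, Y'). path_point Y Y' i) (pair_pmf (random_bits N p) (random_bits N p)) =
    random_bits N p"
  using assms
proof (induction i)
  case 0
  show ?case
    using map_fst_pair_pmf[of "random_bits N p" "random_bits N p"]
    by (simp add: case_prod_unfold)
next
  case (Suc i)
  let ?\<mu> = "random_bits N p"
  have "map_pmf (\<lambda>(Y, Y'). path_point Y Y' (Suc i)) (pair_pmf ?\<mu> ?\<mu>) =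
      bind_pmf ?\<mu> (\<lambda>Y. bind_pmf ?\<mu> (\<lambda>Y'. return_pmf ((path_point Y Y' i)(i := Y' i))))"
    by (simp add: pair_pmf_def map_bind_pmf path_point_Suc)
  also have "\<dots> = bind_pmf ?\<mu> (\<lambda>Y. bind_pmf (bernoulli_pmf p) (\<lambda>b. bind_pmf ?\<mu>
      (\<lambda>Y'. return_pmf ((path_point Y Y' i)(i := b)))))"
  proof (intro bind_pmf_cong refl)
    fix Y
    have [simp]: "path_point Y (Y'(i := b)) i = path_point Y Y' i" for Y' b
      by (auto simp: path_point_def)
    have "bind_pmf ?\<mu> (\<lambda>Y'. return_pmf ((path_point Y Y' i)(i := Y' i))) =
      bind_pmf (bind_pmf (bernoulli_pmf p) (\<lambda>b. map_pmf (\<lambda>y. y(i := b)) ?\<mu>))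
        (\<lambda>Y'. return_pmf ((path_point Y Y' i)(i := Y' i)))"
      using Suc.prems by (subst random_bits_resample[of i N p, symmetric]) auto
    also have "\<dots> = bind_pmf (bernoulli_pmf p) (\<lambda>b. bind_pmf ?\<mu>
      (\<lambda>Y'. return_pmf ((path_point Y Y' i)(i := b))))"
      by (simp add: bind_assoc_pmf bind_map_pmf)
    finally show "bind_pmf ?\<mu> (\<lambda>Y'. return_pmf ((path_point Y Y' i)(i := Y' i))) = \<dots>" .
  qed
  also have "\<dots> = bind_pmf (bernoulli_pmf p) (\<lambda>b. bind_pmf ?\<mu> (\<lambda>Y. bind_pmf ?\<mu>
      (\<lambda>Y'. return_pmf ((path_point Y Y' i)(i := b)))))"
    by (rule bind_commute_pmf)
  also have "\<dots> = bind_pmf (bernoulli_pmf p) (\<lambda>b. map_pmf (\<lambda>z. z(i := b))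
      (map_pmf (\<lambda>(Y, Y'). path_point Y Y' i) (pair_pmf ?\<mu> ?\<mu>)))"
    by (simp add: pair_pmf_def map_bind_pmf map_pmf_comp)
  also have "\<dots> = ?\<mu>"
    using Suc random_bits_resample[of i N p] by simp
  finally show ?case .
qed

section \<open>Paths that avoid bad flips\<close>

text \<open>The path towards \<open>Y'\<close> that is in \<open>z\<close> at time \<open>j\<close>, at time \<open>i\<close>.\<close>

definition detour :: "(nat \<Rightarrow> bool) \<Rightarrow> (nat \<Rightarrow> bool) \<Rightarrow> nat \<Rightarrow> nat \<Rightarrow> nat \<Rightarrow> bool" where
  "detour z Y' j i = (\<lambda>l. if j \<le> l \<and> l < i then Y' l else z l)"

text \<open>A step that leaves the current bit unchanged is harmless even in a bad position, and before time
  \<open>i\<close> coordinate \<open>i\<close> still has its value in \<open>z\<close>.\<close>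

definition avoid_prob ::
  "nat \<Rightarrow> real \<Rightarrow> (nat \<Rightarrow> (nat \<Rightarrow> bool) set) \<Rightarrow> nat \<Rightarrow> (nat \<Rightarrow> bool) \<Rightarrow> real" where
  "avoid_prob N p B j z = measure_pmf.expectation (random_bits N p)
     (\<lambda>Y'. of_bool (\<forall>i\<in>{j..<N}. detour z Y' j i \<in> B i \<longrightarrow> Y' i = z i))"

lemma avoid_prob_end [simp]: "avoid_prob N p B N z = 1"
  by (simp add: avoid_prob_def)

text \<open>Condition on the bit \<open>Y' j\<close>. The constraint at time \<open>j\<close>
  concerns \<open>z\<close> alone, and from time \<open>j + 1\<close> on the path is the one that
  starts in \<open>z(j := b)\<close>; the bits of \<open>z\<close> with which later steps are
  compared are untouched.\<close>

lemma avoid_prob_step: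
  assumes "j < N" and "0 \<le> p" "p \<le> 1"
  shows "avoid_prob N p B j z =
    p * of_bool (z \<in> B j \<longrightarrow> z j) * avoid_prob N p B (Suc j) (z(j := True)) +
    (1 - p) * of_bool (z \<in> B j \<longrightarrow> \<not> z j) * avoid_prob N p B (Suc j) (z(j := False))"
proof -
  let ?E = "measure_pmf.expectation (random_bits N p)"
  have *: "?E (\<lambda>Y'. of_bool (\<forall>i\<in>{j..<N}. detour z (Y'(j := b)) j i \<in> B i \<longrightarrow> (Y'(j := b)) i = z i)) =
      of_bool (z \<in> B j \<longrightarrow> z j = b) * avoid_prob N p B (Suc j) (z(j := b))" for b
  proof -
    have d: "detour z (Y'(j := b)) j i = (if i = j then z else detour (z(j := b)) Y' (Suc j) i)"
      if "j \<le> i" for Y' i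
      using that by (auto simp: detour_def fun_eq_iff)
    have split: "{j..<N} = insert j {Suc j..<N}"
      using assms by auto
    have "(\<forall>i\<in>{j..<N}. detour z (Y'(j := b)) j i \<in> B i \<longrightarrow> (Y'(j := b)) i = z i) \<longleftrightarrow>
        (z \<in> B j \<longrightarrow> z j = b) \<and>
        (\<forall>i\<in>{Suc j..<N}. detour (z(j := b)) Y' (Suc j) i \<in> B i \<longrightarrow> Y' i = (z(j := b)) i)" for Y'
      unfolding split by (auto simp: d)
    then show ?thesis
      by (simp add: avoid_prob_def of_bool_conj)
  qed
  show ?thesis
    unfolding avoid_prob_def[of N p B j z]
    by (subst expectation_resample[OF assms]) (simp only: *, simp)
qed

text \<open>The branch that keeps the current bit \<open>z j\<close> is always permitted and has
  positive weight. Positivity is what allows logarithms of these probabilities.\<close>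

lemma avoid_prob_pos:
  assumes "j \<le> N" and "0 < p" "p < 1"
  shows "avoid_prob N p B j z > 0"
  using assms(1)
proof (induction j arbitrary: z rule: inc_induct)
  case base
  show ?case by simp
next
  case (step j)
  have "p * avoid_prob N p B (Suc j) (z(j := True)) > 0"
    "(1 - p) * avoid_prob N p B (Suc j) (z(j := False)) > 0"
    using step.IH assms by simp_all
  then show ?case
    using step.hyps assms by (subst avoid_prob_step) auto
qed

lemma ln_weighted_mean_ge:
  fixes a b p :: real
  assumes "0 < a" "0 < b" "0 < p" "p < 1"
  shows "p * ln a + (1 - p) * ln b \<le> ln (p * a + (1 - p) * b)"
proof -
  have "concave_on {0<..} (ln :: real \<Rightarrow> real)"
    by (rule ln_concave)
  then show ?thesis
    using concave_onD[of "{0<..}" ln "1 - p" a b] assms by simp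
qed

definition bernoulli_entropy :: "real \<Rightarrow> real" where
  "bernoulli_entropy p = - p * ln p - (1 - p) * ln (1 - p)"

text \<open>Outside \<open>B j\<close> the avoidance probability is the mean over both branches, and
  concavity of \<open>ln\<close> loses nothing in the required direction. Inside \<open>B j\<close>
  only the branch with \<open>Y' j = z j\<close> survives; its weight is \<open>p\<close> or
  \<open>1 - p\<close> according to \<open>z j\<close>, and averaging the logarithm of this weight
  over \<open>z j\<close> gives minus the entropy. By \<open>inv\<close>, membership in
  \<open>B j\<close> is unaffected by this averaging.\<close>

lemma expectation_ln_avoid_step:
  assumes j: "j < N" and p: "0 < p" "p < 1"
    and inv: "\<And>y b. y(j := b) \<in> B j \<longleftrightarrow> y \<in> B j"
  shows "measure_pmf.expectation (random_bits N p) (\<lambda>z. ln (avoid_prob N p B (Suc j) z))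
      - bernoulli_entropy p * measure_pmf.prob (random_bits N p) (B j)
    \<le> measure_pmf.expectation (random_bits N p) (\<lambda>z. ln (avoid_prob N p B j z))"
proof -
  let ?\<mu> = "random_bits N p"
  let ?E = "measure_pmf.expectation ?\<mu>"
  let ?G = "avoid_prob N p B"
  let ?a = "\<lambda>b z. ln (?G (Suc j) (z(j := b)))"
  have pointwise: "p * ?a True z + (1 - p) * ?a False z - bernoulli_entropy p * indicator (B j) z
      \<le> p * ln (?G j (z(j := True))) + (1 - p) * ln (?G j (z(j := False)))" for z
  proof -
    have pos: "?G (Suc j) y > 0" for y
      using j p by (intro avoid_prob_pos) auto
    show ?thesis
    proof (cases "z \<in> B j")
      case True
      have G: "?G j (z(j := True)) = p * ?G (Suc j) (z(j := True))"
        "?G j (z(j := False)) = (1 - p) * ?G (Suc j) (z(j := False))"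
        using True p by (auto simp: avoid_prob_step[OF j] inv)
      have lnG: "ln (?G j (z(j := True))) = ln p + ?a True z"
        "ln (?G j (z(j := False))) = ln (1 - p) + ?a False z"
        unfolding G using p pos[of "z(j := True)"] pos[of "z(j := False)"] by (simp_all add: ln_mult)
      show ?thesis
        unfolding lnG using True by (simp add: bernoulli_entropy_def algebra_simps)
    next
      case False
      have G: "?G j (z(j := b)) =
          p * ?G (Suc j) (z(j := True)) + (1 - p) * ?G (Suc j) (z(j := False))" for b
        using False p by (subst avoid_prob_step[OF j]) (auto simp: inv)
      have "p * ln (?G j (z(j := True))) + (1 - p) * ln (?G j (z(j := False))) =
          ln (p * ?G (Suc j) (z(j := True)) + (1 - p) * ?G (Suc j) (z(j := False)))"
        unfolding G by (simp only: distrib_right[symmetric]) simp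
      then show ?thesis
        using False ln_weighted_mean_ge[OF pos pos p] by simp
    qed
  qed
  \<comment> \<open>Both expectations are split according to bit \<open>j\<close> of the starting
    point, so that the two sides can be compared pointwise.\<close>
  have "?E (\<lambda>z. ln (?G (Suc j) z)) - bernoulli_entropy p * measure_pmf.prob ?\<mu> (B j) =
      ?E (\<lambda>z. p * ?a True z + (1 - p) * ?a False z - bernoulli_entropy p * indicator (B j) z)"
    using p by (subst expectation_resample[OF j]) auto
  also have "\<dots> \<le> ?E (\<lambda>z. p * ln (?G j (z(j := True))) + (1 - p) * ln (?G j (z(j := False))))"
    by (intro integral_mono pointwise) auto
  also have "\<dots> = ?E (\<lambda>z. ln (?G j z))"
    using p by (subst expectation_resample[OF j, of p "\<lambda>z. ln (?G j z)"]) auto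
  finally show ?thesis .
qed

text \<open>The one-step bounds add up backwards from time \<open>N\<close>, where the logarithm is
  0, to time 0. Jensen's inequality then passes from the expected logarithm to the logarithm of the
  expectation, which is the probability over both endpoints.\<close>

lemma path_avoids_prob:
  assumes p: "0 < p" "p < 1"
    and inv: "\<And>j y b. j < N \<Longrightarrow> y(j := b) \<in> B j \<longleftrightarrow> y \<in> B j"
  shows "exp (- bernoulli_entropy p * (\<Sum>j<N. measure_pmf.prob (random_bits N p) (B j)))
    \<le> measure_pmf.prob (pair_pmf (random_bits N p) (random_bits N p))
        {(Y, Y'). \<forall>i<N. path_point Y Y' i \<in> B i \<longrightarrow> Y' i = Y i}"
proof -
  let ?\<mu> = "random_bits N p"
  let ?E = "measure_pmf.expectation ?\<mu>"
  let ?G = "avoid_prob N p B"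
  have ind: "- bernoulli_entropy p * (\<Sum>i=j..<N. measure_pmf.prob ?\<mu> (B i)) \<le> ?E (\<lambda>z. ln (?G j z))"
    if "j \<le> N" for j
    using that
  proof (induction j rule: inc_induct)
    case base
    show ?case by simp
  next
    case (step j)
    have "(\<Sum>i=j..<N. measure_pmf.prob ?\<mu> (B i)) =
        measure_pmf.prob ?\<mu> (B j) + (\<Sum>i=Suc j..<N. measure_pmf.prob ?\<mu> (B i))"
      using step.hyps by (intro sum.atLeast_Suc_lessThan) auto
    then show ?case
      using step.IH expectation_ln_avoid_step[where N = N and j = j and B = B, OF _ p inv] step.hyps
      by (simp add: algebra_simps)
  qed
  have "- ln (?E (?G 0)) \<le> ?E (\<lambda>z. - ln (?G 0 z))"
  proof (rule measure_pmf.jensens_inequality[where I = "{0<..}"])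
    show "AE z in measure_pmf ?\<mu>. ?G 0 z \<in> {0<..}"
      using avoid_prob_pos[of 0 N p B] p by (auto intro: AE_I2)
    show "convex_on {0<..} (\<lambda>x::real. - ln x)"
      using ln_concave by (simp add: concave_on_def)
  qed auto
  then have "- bernoulli_entropy p * (\<Sum>j<N. measure_pmf.prob ?\<mu> (B j)) \<le> ln (?E (?G 0))"
    using ind[of 0] by (simp add: lessThan_atLeast0)
  moreover have "?E (?G 0) > 0"
  proof -
    have "finite (set_pmf ?\<mu>)" by simp
    then have "?E (?G 0) = (\<Sum>z\<in>set_pmf ?\<mu>. ?G 0 z * pmf ?\<mu> z)"
      by (subst integral_measure_pmf_real[where A = "set_pmf ?\<mu>"]) auto
    also have "\<dots> > 0"
      using p by (intro sum_pos) (auto simp: pmf_positive avoid_prob_pos set_pmf_not_empty)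
    finally show ?thesis .
  qed
  ultimately have "exp (- bernoulli_entropy p * (\<Sum>j<N. measure_pmf.prob ?\<mu> (B j))) \<le> ?E (?G 0)"
    by (metis exp_le_cancel_iff exp_ln)
  also have "?E (?G 0) = measure_pmf.expectation (pair_pmf ?\<mu> ?\<mu>)
      (indicator {(Y, Y'). \<forall>i<N. path_point Y Y' i \<in> B i \<longrightarrow> Y' i = Y i})"
  proof -
    have "detour z Y' 0 = path_point z Y'" for z Y'
      by (simp add: detour_def path_point_def fun_eq_iff)
    then have "?G 0 = (\<lambda>z. ?E (\<lambda>Y'.
        indicator {(Y, Y'). \<forall>i<N. path_point Y Y' i \<in> B i \<longrightarrow> Y' i = Y i} (z, Y')))"
      by (intro ext) (simp add: avoid_prob_def indicator_def Ball_def)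
    then show ?thesis
      by (subst expectation_pair_finite) simp_all
  qed
  finally show ?thesis by simp
qed

text \<open>The factor \<open>p * (1 - p)\<close> is the one that appears in the total influence
  bound, so the two estimates can be multiplied without a loss for small \<open>p\<close>.\<close>

lemma bernoulli_entropy_le:
  assumes "0 < p" "p \<le> 1/2"
  shows "bernoulli_entropy p \<le> 4 * (p * (1 - p)) * ln (1 / p)"
proof -
  have "- ln (1 - p) \<le> 2 * p * ln 2"
  proof -
    \<comment> \<open>The chord of \<open>ln\<close> between 1/2 and 1: \<open>1 - p\<close> is the
      mean of 1 and 1/2 with weights \<open>1 - 2 * p\<close> and \<open>2 * p\<close>. At
      \<open>p = 1/2\<close> the first weight vanishes, hence the separate case.\<close>
    have "- ln (1 - p) \<le> 2 * p * ln 2" if "p < 1/2"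
      using that assms ln_weighted_mean_ge[of 1 "1/2" "1 - 2 * p"] by (simp add: ln_div)
    moreover have "- ln (1 - p) \<le> 2 * p * ln 2" if "p = 1/2"
      unfolding that by (simp add: ln_div)
    ultimately show ?thesis
      using assms(2) by (metis order_le_less)
  qed
  also have "\<dots> \<le> 2 * p * ln (1 / p)"
    using assms by (intro mult_left_mono) (auto simp: field_simps)
  finally have "(1 - p) * (- ln (1 - p)) \<le> (1 - p) * (2 * p * ln (1 / p))"
    using assms by (intro mult_left_mono) auto
  moreover have "p * ln (1 / p) \<le> 2 * (p * (1 - p)) * ln (1 / p)"
  proof -
    have "p * (1 - 2 * p) * ln (1 / p) \<ge> 0"
      using assms by (intro mult_nonneg_nonneg) auto
    then show ?thesis by (simp add: algebra_simps)
  qed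
  moreover have "bernoulli_entropy p = p * ln (1 / p) + (1 - p) * (- ln (1 - p))"
    using assms by (simp add: bernoulli_entropy_def ln_div)
  moreover have "2 * (p * (1 - p)) * ln (1 / p) = (1 - p) * (2 * p * ln (1 / p))"
    by (simp only: mult_ac)
  ultimately show ?thesis
    by linarith
qed

section \<open>Total influence of low-degree polynomials\<close>

text \<open>The \<open>p\<close>-biased Fourier basis, left unnormalised so that no square roots of
  the variance \<open>p * (1 - p)\<close> occur.\<close>

definition character :: "real \<Rightarrow> nat set \<Rightarrow> (nat \<Rightarrow> bool) \<Rightarrow> real" where
  "character p S y = (\<Prod>j\<in>S. of_bool (y j) - p)"

lemma expectation_random_bits_cong:
  fixes g h :: "(nat \<Rightarrow> bool) \<Rightarrow> real"
  assumes "\<And>y. y \<in> cube N \<Longrightarrow> g y = h y"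
  shows "measure_pmf.expectation (random_bits N p) g = measure_pmf.expectation (random_bits N p) h"
  using assms set_random_bits by (intro integral_cong_AE) (auto simp: AE_measure_pmf_iff)

lemma character_update:
  assumes "finite S"
  shows "character p S (y(i := b)) =
    (if i \<in> S then (of_bool b - p) * character p (S - {i}) y else character p S y)"
proof -
  have *: "character p T (y(i := b)) = character p T y" if "i \<notin> T" for T
    unfolding character_def using that by (intro prod.cong) auto
  show ?thesis
  proof (cases "i \<in> S")
    case True
    have "character p S (y(i := b)) = (of_bool b - p) * character p (S - {i}) (y(i := b))"
      unfolding character_def using assms True by (subst prod.remove[of S i]) auto
    then show ?thesis
      using True by (simp add: *)
  qed (simp add: *)
qed

text \<open>A coordinate in only one of the two sets contributes a centred factor, which averages to
  0. If the sets agree, each coordinate contributes its variance.\<close>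

lemma expectation_character_mult:
  assumes p: "0 \<le> p" "p \<le> 1" and S: "S \<subseteq> {..<N}" and T: "T \<subseteq> {..<N}"
  shows "measure_pmf.expectation (random_bits N p) (\<lambda>y. character p S y * character p T y) =
    (if S = T then (p * (1 - p)) ^ card S else 0)"
proof (cases "S = T")
  case False
  then obtain i where i: "i \<in> S \<and> i \<notin> T \<or> i \<notin> S \<and> i \<in> T"
    by auto
  have fin: "finite S" "finite T"
    using S T finite_subset by auto
  have "i < N"
    using i S T by auto
  then show ?thesis
    using False i p
    by (subst expectation_resample[of i]) (auto simp: character_update fin algebra_simps)
next
  case True
  have fin: "finite S"
    using S finite_subset by auto
  show ?thesis
    using fin S unfolding True[symmetric]
  proof (induction S)
    case empty
    show ?case by (simp add: character_def)
  next
    case (insert i S)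
    let ?X = "measure_pmf.expectation (random_bits N p) (\<lambda>y. character p S y * character p S y)"
    have "measure_pmf.expectation (random_bits N p)
        (\<lambda>y. character p (insert i S) y * character p (insert i S) y) =
      p * ((1 - p) * (1 - p) * ?X) + (1 - p) * (p * p * ?X)"
    proof -
      have "i < N" using insert.prems by simp
      have "character p (insert i S) (y(i := b)) * character p (insert i S) (y(i := b)) =
          (of_bool b - p) * (of_bool b - p) * (character p S y * character p S y)" for y b
        using insert.hyps by (simp add: character_update)
      then show ?thesis
        using \<open>i < N\<close> p by (subst expectation_resample[of i]) auto
    qed
    also have "\<dots> = p * (1 - p) * ?X"
      by (simp add: algebra_simps)
    finally show ?case
      using insert by simp
  qed
qed

text \<open>Parseval's identity. The index map \<open>s\<close> is there for discrete derivatives,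
  whose expansions run over the sets \<open>S - {i}\<close> and are indexed by
  \<open>S\<close>.\<close>

lemma expectation_square_characters:
  assumes p: "0 \<le> p" "p \<le> 1" and I: "finite I" "inj_on s I" "\<And>a. a \<in> I \<Longrightarrow> s a \<subseteq> {..<N}"
  shows "measure_pmf.expectation (random_bits N p) (\<lambda>y. (\<Sum>a\<in>I. c a * character p (s a) y)\<^sup>2) =
    (\<Sum>a\<in>I. (c a)\<^sup>2 * (p * (1 - p)) ^ card (s a))"
proof -
  let ?E = "measure_pmf.expectation (random_bits N p)"
  have "?E (\<lambda>y. (\<Sum>a\<in>I. c a * character p (s a) y)\<^sup>2) =
      ?E (\<lambda>y. \<Sum>a\<in>I. \<Sum>b\<in>I. c a * c b * (character p (s a) y * character p (s b) y))"
    by (simp add: power2_eq_square sum_product mult_ac)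
  also have "\<dots> = (\<Sum>a\<in>I. \<Sum>b\<in>I. c a * c b * ?E (\<lambda>y. character p (s a) y * character p (s b) y))"
    by (simp add: Bochner_Integration.integral_sum)
  also have "\<dots> = (\<Sum>a\<in>I. \<Sum>b\<in>I. if b = a then (c a)\<^sup>2 * (p * (1 - p)) ^ card (s a) else 0)"
    using I by (intro sum.cong refl)
      (auto simp: expectation_character_mult[OF p] power2_eq_square inj_on_def)
  also have "\<dots> = (\<Sum>a\<in>I. (c a)\<^sup>2 * (p * (1 - p)) ^ card (s a))"
    using I by simp
  finally show ?thesis .
qed

text \<open>On Boolean inputs a monomial depends only on its support, which has at most
  \<open>D\<close> elements because every exponent there is at least 1. Writing each variable as
  \<open>(y j - p) + p\<close> and expanding the product gives characters of subsets of the
  support.\<close>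

lemma poly_deg_le_characters:
  assumes "poly_deg_le N D g"
  shows "\<exists>c. \<forall>y\<in>cube N. g y = (\<Sum>S | S \<subseteq> {..<N} \<and> card S \<le> D. c S * character p S y)"
proof -
  obtain c where c: "\<And>y. y \<in> cube N \<Longrightarrow>
      g y = (\<Sum>\<alpha>\<in>exponents N D. c \<alpha> * (\<Prod>j<N. of_bool (y j) ^ \<alpha> j))"
    using assms unfolding poly_deg_le_def by blast
  let ?L = "{S. S \<subseteq> {..<N} \<and> card S \<le> D}"
  let ?supp = "\<lambda>\<alpha>. {j \<in> {..<N}. \<alpha> j \<noteq> (0::nat)}"
  let ?a = "\<lambda>\<alpha> S. if S \<subseteq> ?supp \<alpha> then p ^ card (?supp \<alpha> - S) else 0"
  have mono: "(\<Prod>j<N. of_bool (y j) ^ \<alpha> j) = (\<Sum>S\<in>?L. ?a \<alpha> S * character p S y)"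
    if "\<alpha> \<in> exponents N D" for \<alpha> y
  proof -
    define A where "A = ?supp \<alpha>"
    have A: "finite A" "A \<subseteq> {..<N}" and A_iff: "j \<in> A \<longleftrightarrow> j < N \<and> \<alpha> j \<noteq> 0" for j
      by (auto simp: A_def)
    have "card A = (\<Sum>j\<in>A. 1)"
      by simp
    also have "\<dots> \<le> (\<Sum>j\<in>A. \<alpha> j)"
      by (rule sum_mono) (simp add: A_iff)
    also have "\<dots> \<le> (\<Sum>j<N. \<alpha> j)"
      using A by (intro sum_mono2) auto
    also have "\<dots> \<le> D"
      using that by (simp add: exponents_def)
    finally have "card S \<le> D" if "S \<subseteq> A" for S
      using card_mono[OF A(1) that] by simp
    then have sub: "Pow A \<subseteq> ?L"
      using A by blast
    have finL: "finite ?L"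
      by (rule finite_subset[of _ "Pow {..<N}"]) auto
    have "(\<Prod>j<N. of_bool (y j) ^ \<alpha> j) = (\<Prod>j\<in>A. of_bool (y j) ^ \<alpha> j :: real)"
      using A by (intro prod.mono_neutral_right) (auto simp: A_iff)
    also have "\<dots> = (\<Prod>j\<in>A. (of_bool (y j) - p) + p)"
      by (rule prod.cong) (auto simp: A_iff)
    also have "\<dots> = (\<Sum>S\<in>Pow A. character p S y * p ^ card (A - S))"
      unfolding prod_add[OF A(1)] character_def prod_constant ..
    also have "\<dots> = (\<Sum>S\<in>Pow A. (if S \<subseteq> A then p ^ card (A - S) else 0) * character p S y)"
      by (rule sum.cong) simp_all
    also have "\<dots> = (\<Sum>S\<in>?L. (if S \<subseteq> A then p ^ card (A - S) else 0) * character p S y)"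
      using finL sub by (rule sum.mono_neutral_left) simp
    finally show ?thesis
      by (simp only: A_def)
  qed
  have "g y = (\<Sum>S\<in>?L. (\<Sum>\<alpha>\<in>exponents N D. c \<alpha> * ?a \<alpha> S) * character p S y)" if "y \<in> cube N" for y
  proof -
    have "g y = (\<Sum>\<alpha>\<in>exponents N D. \<Sum>S\<in>?L. c \<alpha> * ?a \<alpha> S * character p S y)"
      unfolding c[OF that]
    proof (rule sum.cong)
      fix \<alpha> assume "\<alpha> \<in> exponents N D"
      show "c \<alpha> * (\<Prod>j<N. of_bool (y j) ^ \<alpha> j) = (\<Sum>S\<in>?L. c \<alpha> * ?a \<alpha> S * character p S y)"
        unfolding mono[OF \<open>\<alpha> \<in> exponents N D\<close>] sum_distrib_left mult.assoc ..
    qed (rule refl)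
    also have "\<dots> = (\<Sum>S\<in>?L. \<Sum>\<alpha>\<in>exponents N D. c \<alpha> * ?a \<alpha> S * character p S y)"
      by (rule sum.swap)
    finally show ?thesis
      unfolding sum_distrib_right .
  qed
  then show ?thesis
    by (intro exI[of _ "\<lambda>S. \<Sum>\<alpha>\<in>exponents N D. c \<alpha> * ?a \<alpha> S"] ballI)
qed

text \<open>The derivative in direction \<open>i\<close> kills the characters without
  \<open>i\<close> and strips \<open>i\<close> from the others; the factor
  \<open>p * (1 - p)\<close> restores the lost variance. Summed over \<open>i\<close>, the Fourier
  weight of \<open>S\<close> is counted \<open>card S\<close> times, hence at most \<open>D\<close>
  times.\<close>

lemma total_influence_le:
  assumes p: "0 \<le> p" "p \<le> 1" and g: "poly_deg_le N D g"
  shows "p * (1 - p) * (\<Sum>i<N. measure_pmf.expectation (random_bits N p)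
      (\<lambda>y. (g (y(i := True)) - g (y(i := False)))\<^sup>2))
    \<le> D * measure_pmf.expectation (random_bits N p) (\<lambda>y. (g y)\<^sup>2)"
proof -
  let ?E = "measure_pmf.expectation (random_bits N p)"
  let ?v = "p * (1 - p)"
  define L where "L = {S. S \<subseteq> {..<N} \<and> card S \<le> D}"
  have finL: "finite L"
    by (rule finite_subset[of _ "Pow {..<N}"]) (auto simp: L_def)
  have finS: "finite S" if "S \<in> L" for S
    using that finite_subset by (auto simp: L_def)
  obtain c where c: "\<And>y. y \<in> cube N \<Longrightarrow> g y = (\<Sum>S\<in>L. c S * character p S y)"
    using poly_deg_le_characters[OF g] unfolding L_def by meson
  have v: "?v \<ge> 0"
    using p by simp
  have diff: "?v * ?E (\<lambda>y. (g (y(i := True)) - g (y(i := False)))\<^sup>2) =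
      (\<Sum>S\<in>L. of_bool (i \<in> S) * ((c S)\<^sup>2 * ?v ^ card S))" if i: "i < N" for i
  proof -
    have "?E (\<lambda>y. (g (y(i := True)) - g (y(i := False)))\<^sup>2) =
        ?E (\<lambda>y. (\<Sum>S\<in>{S \<in> L. i \<in> S}. c S * character p (S - {i}) y)\<^sup>2)"
    proof (rule expectation_random_bits_cong)
      fix y assume "y \<in> cube N"
      then have cube: "y(i := b) \<in> cube N" for b
        using i by (auto simp: cube_def)
      have "g (y(i := True)) - g (y(i := False)) =
          (\<Sum>S\<in>L. c S * (character p S (y(i := True)) - character p S (y(i := False))))"
        by (simp add: c[OF cube] sum_subtractf right_diff_distrib)
      also have "\<dots> = (\<Sum>S\<in>L. if i \<in> S then c S * character p (S - {i}) y else 0)"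
        \<comment> \<open>The factor of coordinate \<open>i\<close> takes the values
          \<open>1 - p\<close> and \<open>- p\<close>, whose difference is 1.\<close>
        by (intro sum.cong refl) (auto simp: character_update finS algebra_simps)
      also have "\<dots> = (\<Sum>S\<in>{S \<in> L. i \<in> S}. c S * character p (S - {i}) y)"
        using finL by (simp add: sum.inter_filter)
      finally show "(g (y(i := True)) - g (y(i := False)))\<^sup>2 =
          (\<Sum>S\<in>{S \<in> L. i \<in> S}. c S * character p (S - {i}) y)\<^sup>2"
        by simp
    qed
    also have "\<dots> = (\<Sum>S\<in>{S \<in> L. i \<in> S}. (c S)\<^sup>2 * ?v ^ card (S - {i}))"
      using finL p by (intro expectation_square_characters) (auto simp: L_def inj_on_def)
    finally have "?v * ?E (\<lambda>y. (g (y(i := True)) - g (y(i := False)))\<^sup>2) =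
        (\<Sum>S\<in>{S \<in> L. i \<in> S}. (c S)\<^sup>2 * (?v * ?v ^ card (S - {i})))"
      by (simp only: sum_distrib_left mult.left_commute)
    also have "\<dots> = (\<Sum>S\<in>{S \<in> L. i \<in> S}. (c S)\<^sup>2 * ?v ^ card S)"
    proof (intro sum.cong refl)
      fix S assume "S \<in> {S \<in> L. i \<in> S}"
      then have "card S = Suc (card (S - {i}))"
        by (intro card.remove finS) auto
      then show "(c S)\<^sup>2 * (?v * ?v ^ card (S - {i})) = (c S)\<^sup>2 * ?v ^ card S"
        by simp
    qed
    also have "\<dots> = (\<Sum>S\<in>L. if i \<in> S then (c S)\<^sup>2 * ?v ^ card S else 0)"
      using finL by (rule sum.inter_filter)
    also have "\<dots> = (\<Sum>S\<in>L. of_bool (i \<in> S) * ((c S)\<^sup>2 * ?v ^ card S))"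
      by (intro sum.cong refl) auto
    finally show ?thesis .
  qed
  have "?v * (\<Sum>i<N. ?E (\<lambda>y. (g (y(i := True)) - g (y(i := False)))\<^sup>2)) =
      (\<Sum>i<N. \<Sum>S\<in>L. of_bool (i \<in> S) * ((c S)\<^sup>2 * ?v ^ card S))"
    unfolding sum_distrib_left by (intro sum.cong refl) (simp add: diff)
  also have "\<dots> = (\<Sum>S\<in>L. (\<Sum>i<N. of_bool (i \<in> S)) * ((c S)\<^sup>2 * ?v ^ card S))"
    by (subst sum.swap) (simp add: sum_distrib_right)
  also have "\<dots> \<le> (\<Sum>S\<in>L. D * ((c S)\<^sup>2 * ?v ^ card S))"
  proof (intro sum_mono mult_right_mono)
    fix S assume "S \<in> L"
    then have "{..<N} \<inter> S = S" "card S \<le> D"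
      by (auto simp: L_def)
    then show "(\<Sum>i<N. of_bool (i \<in> S)) \<le> real D"
      by simp
  qed (use v in auto)
  also have "\<dots> = D * ?E (\<lambda>y. (\<Sum>S\<in>L. c S * character p S y)\<^sup>2)"
    using finL p by (subst expectation_square_characters[where s = "\<lambda>S. S"])
      (auto simp: L_def sum_distrib_left)
  also have "?E (\<lambda>y. (\<Sum>S\<in>L. c S * character p S y)\<^sup>2) = ?E (\<lambda>y. (g y)\<^sup>2)"
    by (intro expectation_random_bits_cong) (simp add: c)
  finally show ?thesis .
qed

section \<open>Stability along the path\<close>

text \<open>Markov's inequality bounds the probability of a large jump in direction \<open>j\<close>
  by the influence of \<open>j\<close>, so the total influence bound controls the sum of these
  probabilities. The entropy estimate turns that sum into the exponent for
  \<open>path_avoids_prob\<close>.\<close>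

lemma low_degree_stable_on_path:
  fixes f :: "(nat \<Rightarrow> bool) \<Rightarrow> nat \<Rightarrow> real"
  assumes p: "0 < p" "p \<le> 1/2" and \<tau>: "0 < \<tau>"
    and deg: "\<And>i. i < n \<Longrightarrow> poly_deg_le N D (\<lambda>y. f y i)"
    and energy: "measure_pmf.expectation (random_bits N p) (\<lambda>y. \<Sum>i<n. (f y i)\<^sup>2) \<le> T"
  shows "exp (- (4 * real D * T / \<tau> * ln (1 / p)))
    \<le> measure_pmf.prob (pair_pmf (random_bits N p) (random_bits N p))
        {(Y, Y'). \<forall>j<N. (\<Sum>i<n. (f (path_point Y Y' j) i - f (path_point Y Y' (Suc j)) i)\<^sup>2) < \<tau>}"
proof -
  let ?\<mu> = "random_bits N p"
  let ?E = "measure_pmf.expectation ?\<mu>"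
  define jump where "jump = (\<lambda>j y. \<Sum>i<n. (f (y(j := True)) i - f (y(j := False)) i)\<^sup>2)"
  \<comment> \<open>\<open>jump\<close> compares both values of bit \<open>j\<close>, so membership
    in \<open>B j\<close> ignores the current one, as \<open>path_avoids_prob\<close>
    demands.\<close>
  define B where "B = (\<lambda>j. {y. \<tau> \<le> jump j y})"
  have inv: "y(j := b) \<in> B j \<longleftrightarrow> y \<in> B j" for j y b
    by (simp add: B_def jump_def)
  have jump_nonneg: "0 \<le> jump j y" for j y
    by (simp add: jump_def sum_nonneg)
  have markov: "\<tau> * measure_pmf.prob ?\<mu> (B j) \<le> ?E (jump j)" for j
  proof -
    have "?E (\<lambda>y. \<tau> * indicator (B j) y) \<le> ?E (jump j)"
      by (intro integral_mono) (auto simp: B_def jump_nonneg indicator_def)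
    then show ?thesis by simp
  qed
  have "p * (1 - p) * (\<tau> * (\<Sum>j<N. measure_pmf.prob ?\<mu> (B j))) \<le> p * (1 - p) * (\<Sum>j<N. ?E (jump j))"
    using p markov by (intro mult_left_mono) (auto simp: sum_distrib_left intro: sum_mono)
  also have "\<dots> = (\<Sum>i<n. p * (1 - p) * (\<Sum>j<N. ?E (\<lambda>y. (f (y(j := True)) i - f (y(j := False)) i)\<^sup>2)))"
    unfolding jump_def by (simp add: Bochner_Integration.integral_sum sum_distrib_left)
      (rule sum.swap)
  also have "\<dots> \<le> (\<Sum>i<n. D * ?E (\<lambda>y. (f y i)\<^sup>2))"
    using p by (intro sum_mono total_influence_le deg) auto
  also have "\<dots> = D * ?E (\<lambda>y. \<Sum>i<n. (f y i)\<^sup>2)"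
    by (simp add: Bochner_Integration.integral_sum sum_distrib_left)
  also have "\<dots> \<le> D * T"
    using energy by (intro mult_left_mono) auto
  finally have influence: "p * (1 - p) * (\<Sum>j<N. measure_pmf.prob ?\<mu> (B j)) \<le> D * T / \<tau>"
    using \<tau> by (simp add: field_simps)
  have "bernoulli_entropy p * (\<Sum>j<N. measure_pmf.prob ?\<mu> (B j))
      \<le> 4 * (p * (1 - p)) * ln (1 / p) * (\<Sum>j<N. measure_pmf.prob ?\<mu> (B j))"
    using p by (intro mult_right_mono bernoulli_entropy_le) (auto intro: sum_nonneg)
  also have "\<dots> = 4 * ln (1 / p) * (p * (1 - p) * (\<Sum>j<N. measure_pmf.prob ?\<mu> (B j)))"
    by simp
  also have "\<dots> \<le> 4 * ln (1 / p) * (D * T / \<tau>)"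
    using p by (intro mult_left_mono influence) auto
  finally have "exp (- (4 * real D * T / \<tau> * ln (1 / p)))
      \<le> exp (- bernoulli_entropy p * (\<Sum>j<N. measure_pmf.prob ?\<mu> (B j)))"
    by (simp add: mult_ac)
  also have "\<dots> \<le> measure_pmf.prob (pair_pmf ?\<mu> ?\<mu>)
      {(Y, Y'). \<forall>i<N. path_point Y Y' i \<in> B i \<longrightarrow> Y' i = Y i}"
    using p by (intro path_avoids_prob inv) auto
  also have "\<dots> \<le> measure_pmf.prob (pair_pmf ?\<mu> ?\<mu>)
      {(Y, Y'). \<forall>j<N. (\<Sum>i<n. (f (path_point Y Y' j) i - f (path_point Y Y' (Suc j)) i)\<^sup>2) < \<tau>}"
  proof (intro measure_pmf.finite_measure_mono subsetI)
    fix P assume "P \<in> {(Y, Y'). \<forall>i<N. path_point Y Y' i \<in> B i \<longrightarrow> Y' i = Y i}"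
    then obtain Y Y' where P: "P = (Y, Y')"
      and avoid: "\<And>j. j < N \<Longrightarrow> path_point Y Y' j \<in> B j \<Longrightarrow> Y' j = Y j"
      by blast
    have "(\<Sum>i<n. (f (path_point Y Y' j) i - f (path_point Y Y' (Suc j)) i)\<^sup>2) < \<tau>" if "j < N" for j
    proof -
      define z where "z = path_point Y Y' j"
      have zj: "z j = Y j"
        by (simp add: z_def path_point_def)
      have suc: "path_point Y Y' (Suc j) = z(j := Y' j)"
        by (simp add: z_def path_point_Suc)
      show ?thesis
      \<comment> \<open>Either the step stands still and the change is 0, or it flips bit
        \<open>j\<close> outside \<open>B j\<close>, and the change is exactly
        \<open>jump j z\<close>.\<close>
      proof (cases "Y' j = Y j")
        case True
        then have "z(j := Y' j) = z"
          by (simp add: zj[symmetric])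
        then show ?thesis
          using \<tau> by (simp add: suc z_def[symmetric])
      next
        case False
        then have "z \<notin> B j"
          using avoid[OF that] by (auto simp: z_def)
        then have "jump j z < \<tau>"
          by (simp add: B_def)
        moreover have "z = z(j := Y j)"
          by (simp add: zj[symmetric])
        then have "(\<Sum>i<n. (f z i - f (z(j := Y' j)) i)\<^sup>2) = jump j z"
          using False unfolding jump_def
          by (cases "Y j"; cases "Y' j") (auto simp: power2_commute)
        ultimately show ?thesis
          by (simp add: suc z_def[symmetric])
      qed
    qed
    then show "P \<in> {(Y, Y'). \<forall>j<N.
        (\<Sum>i<n. (f (path_point Y Y' j) i - f (path_point Y Y' (Suc j)) i)\<^sup>2) < \<tau>}"
      by (simp add: P)
  qed simp
  finally show ?thesis .
qed

section \<open>Rounding along a path with an overlap gap\<close>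

lemma card_ge_le_sum_squares:
  fixes a :: "nat \<Rightarrow> real"
  assumes "finite I" "0 < s"
  shows "s * card {i \<in> I. s \<le> (a i)\<^sup>2} \<le> (\<Sum>i\<in>I. (a i)\<^sup>2)"
proof -
  have "s * card {i \<in> I. s \<le> (a i)\<^sup>2} = (\<Sum>i\<in>{i \<in> I. s \<le> (a i)\<^sup>2}. s)"
    by simp
  also have "\<dots> \<le> (\<Sum>i\<in>{i \<in> I. s \<le> (a i)\<^sup>2}. (a i)\<^sup>2)"
    by (rule sum_mono) simp
  also have "\<dots> \<le> (\<Sum>i\<in>I. (a i)\<^sup>2)"
    using assms by (intro sum_mono2) auto
  finally show ?thesis .
qed

lemma rounding_subset: "rounding n e \<eta> Y v \<subseteq> {..<n}"
  by (auto simp: rounding_def set_A_tilde_def set_A_def)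

lemma finite_rounding [simp]: "finite (rounding n e \<eta> Y v)"
  using finite_subset[OF rounding_subset] by blast

lemma overlap_indicators:
  assumes "V \<subseteq> {..<n}"
  shows "overlap n (\<lambda>i. i \<in> V) (\<lambda>i. i \<in> W) = real (card (V \<inter> W)) / n"
proof -
  have "(\<Sum>i<n. of_bool (i \<in> V) * of_bool (i \<in> W)) = (\<Sum>i<n. of_bool (i \<in> V \<inter> W) :: real)"
    by (intro sum.cong) auto
  also have "\<dots> = real (card ({..<n} \<inter> (V \<inter> W)))"
    by (simp add: Collect_conj_eq)
  also have "{..<n} \<inter> (V \<inter> W) = V \<inter> W"
    using assms by auto
  finally show ?thesis by (simp add: overlap_def)
qed

lemma indep_obj_rounding:
  "indep_obj n e Y (\<lambda>i. i \<in> rounding n e \<eta> Y v) = card (rounding n e \<eta> Y v)"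
proof -
  have "vsupp n (\<lambda>i. i \<in> rounding n e \<eta> Y v) = rounding n e \<eta> Y v"
    using rounding_subset[of n e \<eta> Y v] by (auto simp: vsupp_def)
  moreover have "independent_in n e Y (rounding n e \<eta> Y v)"
    by (auto simp: independent_in_def rounding_def set_A_tilde_def)
  ultimately show ?thesis by (simp add: indep_obj_def)
qed

text \<open>A vertex that is lost has \<open>v i \<ge> 1\<close>. Under \<open>v'\<close> it is in
  conflict with a neighbour, or it falls in the window (1/2, 1), or its value has dropped by at
  least 1/2. Since the second rounding is nonempty, it passed its test, so the first two kinds
  number at most \<open>\<eta> * n\<close>; each of the third kind adds at least 1/4 to the squared
  distance.\<close>

lemma card_rounding_diff_le:
  fixes v v' :: "nat \<Rightarrow> real"
  assumes "rounding n e \<eta> Y' v' \<noteq> {}"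
  shows "card (rounding n e \<eta> Y v - rounding n e \<eta> Y' v') \<le> \<eta> * n + 4 * (\<Sum>i<n. (v i - v' i)\<^sup>2)"
proof -
  let ?C = "set_A n v' - set_A_tilde n e Y' v'"
  let ?J = "{i \<in> {..<n}. 1/4 \<le> (v i - v' i)\<^sup>2}"
  have V': "rounding n e \<eta> Y' v' = set_A_tilde n e Y' v'"
    and small: "real (card ?C + card (set_B n v')) \<le> \<eta> * n"
    using assms by (auto simp: rounding_def split: if_splits)
  have "rounding n e \<eta> Y v - rounding n e \<eta> Y' v' \<subseteq> ?C \<union> set_B n v' \<union> ?J"
  proof
    fix i assume "i \<in> rounding n e \<eta> Y v - rounding n e \<eta> Y' v'"
    then have i: "i < n" "1 \<le> v i" "i \<notin> set_A_tilde n e Y' v'"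
      unfolding V' by (auto simp: rounding_def set_A_tilde_def set_A_def split: if_splits)
    have "(1/2)\<^sup>2 \<le> (v i - v' i)\<^sup>2" if "v' i \<le> 1/2"
      using that i by (intro power_mono) auto
    then show "i \<in> ?C \<union> set_B n v' \<union> ?J"
      using i by (fastforce simp: set_A_def set_B_def power2_eq_square)
  qed
  moreover have fin: "finite ?C" "finite (set_B n v')"
    by (auto simp: set_A_def set_B_def)
  ultimately have "card (rounding n e \<eta> Y v - rounding n e \<eta> Y' v') \<le> card (?C \<union> set_B n v' \<union> ?J)"
    by (intro card_mono) auto
  also have "\<dots> \<le> card ?C + card (set_B n v') + card ?J"
    by (meson add_le_mono1 card_Un_le le_trans)
  finally show ?thesis
    using small card_ge_le_sum_squares[of "{..<n}" "1/4" "\<lambda>i. v i - v' i"] by simp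
qed

text \<open>Follow the overlap with the initial set \<open>V 0\<close>: it starts at
  \<open>\<nu>2\<close> or above by size, ends at \<open>\<nu>1\<close> or below by separation, and
  cannot lie in between. Some single step crosses the gap, and there the rounded set loses more
  vertices than stability allows.\<close>

lemma no_stable_rounding_along_gapped_path:
  fixes v :: "nat \<Rightarrow> nat \<Rightarrow> real"
  assumes \<nu>: "0 \<le> \<nu>1" "\<nu>1 < \<nu>2" "\<nu>2 \<le> 1" and "0 < n" "0 < k" "\<nu>2 * n \<le> real k"
    and \<eta>: "\<eta> \<le> (\<nu>2 - \<nu>1)\<^sup>2 / 4"
    and cube: "Y \<in> cube (n choose 2)" "Y' \<in> cube (n choose 2)"
    and gap: "overlap_gap (cube n) (overlap n) (real k) \<nu>1 \<nu>2 (path_family n e Y Y')"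
    and sep: "separated_above (cube n) (overlap n) \<nu>1 (real k) (indep_obj n e Y) (indep_obj n e Y')"
    and large: "\<And>t. t \<le> n choose 2 \<Longrightarrow> k \<le> card (rounding n e \<eta> (path_point Y Y' t) (v t))"
    and stable: "\<And>t. t < n choose 2 \<Longrightarrow> (\<Sum>i<n. (v t i - v (Suc t) i)\<^sup>2) < (\<nu>2 - \<nu>1)\<^sup>2 * n / 8"
  shows False
proof -
  define m where "m = n choose 2"
  define V where "V = (\<lambda>t. rounding n e \<eta> (path_point Y Y' t) (v t))"
  define x where "x = (\<lambda>t i. i \<in> V t)"
  have x_cube: "x t \<in> cube n" for t
    using rounding_subset[of n e \<eta>] by (fastforce simp: x_def V_def cube_def)
  have obj: "indep_obj n e (path_point Y Y' t) (x t) \<ge> k" if "t \<le> m" for t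
    using large that by (simp add: x_def V_def indep_obj_rounding m_def)
  have R: "overlap n (x 0) (x t) = card (V 0 \<inter> V t) / n" for t
    unfolding x_def V_def by (intro overlap_indicators rounding_subset)
  have R_gap: "overlap n (x 0) (x t) \<in> {0..\<nu>1} \<union> {\<nu>2..1}" if "t \<le> m" for t
    using gap obj[of 0] obj[OF that] x_cube that
    unfolding overlap_gap_def path_family_def m_def by blast
  have "\<nu>2 \<le> overlap n (x 0) (x 0)"
    using large[of 0] \<open>0 < n\<close> \<open>\<nu>2 * n \<le> k\<close> unfolding R V_def by (simp add: field_simps)
  moreover have "overlap n (x 0) (x m) \<le> \<nu>1"
    using sep obj[of 0] obj[of m] x_cube
    unfolding separated_above_def m_def by (simp add: path_point_full[OF cube])
  ultimately have "\<exists>t<m. \<nu>2 \<le> overlap n (x 0) (x t) \<and> overlap n (x 0) (x (Suc t)) \<le> \<nu>1"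
  proof -
    assume start: "\<nu>2 \<le> overlap n (x 0) (x 0)" and "end": "overlap n (x 0) (x m) \<le> \<nu>1"
    show ?thesis
    proof (rule ccontr)
      assume none: "\<not> ?thesis"
      have "\<nu>2 \<le> overlap n (x 0) (x t)" if "t \<le> m" for t
        using that
      proof (induction t)
        case (Suc t)
        then show ?case
          using none R_gap[of "Suc t"] by auto
      qed (use start in simp)
      from this[of m] "end" \<nu> show False by simp
    qed
  qed
  then obtain t where t: "t < m" "\<nu>2 * n \<le> card (V 0 \<inter> V t)" "card (V 0 \<inter> V (Suc t)) \<le> \<nu>1 * n"
    unfolding R using \<open>0 < n\<close> by (auto simp: field_simps)
  have fin: "finite (V s)" for s
    by (simp add: V_def)
  have "card (V 0 \<inter> V t) \<le> card ((V 0 \<inter> V (Suc t)) \<union> (V t - V (Suc t)))"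
    using fin by (intro card_mono) auto
  also have "\<dots> \<le> card (V 0 \<inter> V (Suc t)) + card (V t - V (Suc t))"
    by (rule card_Un_le)
  finally have "(\<nu>2 - \<nu>1) * n \<le> card (V t - V (Suc t))"
    using t by (simp add: algebra_simps)
  also have "\<dots> \<le> \<eta> * n + 4 * (\<Sum>i<n. (v t i - v (Suc t) i)\<^sup>2)"
    using large[of "Suc t"] t \<open>0 < k\<close> unfolding V_def m_def
    by (intro card_rounding_diff_le) auto
  \<comment> \<open>The threshold in \<open>stable\<close> makes the two parts 1/4 and 1/2 of
    \<open>(\<nu>2 - \<nu>1)\<^sup>2 * n\<close>. Their sum stays below the loss, because
    \<open>\<nu>2 - \<nu>1\<close> is at most 1 and dominates its square.\<close>
  also have "\<dots> < (\<nu>2 - \<nu>1)\<^sup>2 / 4 * n + 4 * ((\<nu>2 - \<nu>1)\<^sup>2 * n / 8)"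
  proof (rule add_le_less_mono)
    show "\<eta> * n \<le> (\<nu>2 - \<nu>1)\<^sup>2 / 4 * n"
      using \<eta> by (rule mult_right_mono) simp
    show "4 * (\<Sum>i<n. (v t i - v (Suc t) i)\<^sup>2) < 4 * ((\<nu>2 - \<nu>1)\<^sup>2 * n / 8)"
      using stable[of t] t(1) unfolding m_def by linarith
  qed
  also have "\<dots> \<le> (\<nu>2 - \<nu>1)\<^sup>2 * n"
    by simp
  also have "\<dots> \<le> (\<nu>2 - \<nu>1) * n"
    using \<nu> by (intro mult_right_mono) (auto simp: power2_eq_square intro: mult_left_le)
  finally show False by simp
qed

section \<open>Fixing the internal randomness\<close>

text \<open>If every \<open>\<omega>\<close> violated one of the two bounds, then failure
  probability over \<open>3 * \<delta>\<close> plus energy over \<open>3 * c\<close> would be at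
  least 1 everywhere, while its mean is at most 1/3 + 1/3. A factor 2 in place of 3 would give only
  1 and no contradiction.\<close>

lemma exists_good_sample:
  fixes F :: "'a \<times> 'w \<Rightarrow> ennreal"
  assumes M: "prob_space M"
    and F: "F \<in> borel_measurable (measure_pmf \<mu> \<Otimes>\<^sub>M M)"
    and c: "0 < c" "integral\<^sup>N (measure_pmf \<mu> \<Otimes>\<^sub>M M) F \<le> ennreal c"
    and S: "S \<in> sets (measure_pmf \<mu> \<Otimes>\<^sub>M M)"
    and \<delta>: "0 < \<delta>" "measure (measure_pmf \<mu> \<Otimes>\<^sub>M M) S \<ge> 1 - \<delta>"
  shows "\<exists>\<omega>\<in>space M. (\<integral>\<^sup>+ y. F (y, \<omega>) \<partial>measure_pmf \<mu>) \<le> ennreal (3 * c) \<and>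
    measure_pmf.prob \<mu> {y. (y, \<omega>) \<in> S} \<ge> 1 - 3 * \<delta>"
proof (rule ccontr)
  assume none: "\<not> ?thesis"
  interpret M: prob_space M by (rule M)
  interpret P: pair_prob_space "measure_pmf \<mu>" M ..
  let ?P = "measure_pmf \<mu> \<Otimes>\<^sub>M M"
  define U where "U = space ?P - S"
  have U[measurable]: "U \<in> sets ?P"
    using S by (simp add: U_def)
  have "measure ?P U \<le> \<delta>"
    using \<delta> P.prob_compl[OF S] by (simp add: U_def)
  then have U_le: "emeasure ?P U \<le> ennreal \<delta>"
    by (simp add: P.emeasure_eq_measure ennreal_leI)
  define a where "a = (\<lambda>\<omega>. emeasure (measure_pmf \<mu>) {y. (y, \<omega>) \<in> U})"
  define b where "b = (\<lambda>\<omega>. \<integral>\<^sup>+ y. F (y, \<omega>) \<partial>measure_pmf \<mu>)"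
  have a_int: "integral\<^sup>N M a \<le> ennreal \<delta>"
    using U_le by (simp add: P.emeasure_pair_measure_alt2[OF U] a_def vimage_def)
  have b_int: "integral\<^sup>N M b \<le> ennreal c"
    using c by (simp add: P.nn_integral_snd[OF F] b_def)
  have a_meas: "a \<in> borel_measurable M"
    using P.measurable_emeasure_Pair2[OF U] by (simp add: a_def vimage_def)
  have b_meas: "b \<in> borel_measurable M"
    unfolding b_def using F by measurable
  have large: "1 \<le> a \<omega> * ennreal (1 / (3 * \<delta>)) + b \<omega> * ennreal (1 / (3 * c))" if \<omega>: "\<omega> \<in> space M" for \<omega>
  proof -
    have scale: "1 \<le> z * ennreal (1 / t)" if "ennreal t \<le> z" "0 < t" for z t
    proof -
      have "1 = ennreal t * ennreal (1 / t)"
        using that by (simp flip: ennreal_mult)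
      also have "\<dots> \<le> z * ennreal (1 / t)"
        using that by (intro mult_right_mono) auto
      finally show ?thesis .
    qed
    consider "\<not> b \<omega> \<le> ennreal (3 * c)" | "\<not> measure_pmf.prob \<mu> {y. (y, \<omega>) \<in> S} \<ge> 1 - 3 * \<delta>"
      using none \<omega> by (auto simp: b_def)
    then show ?thesis
    proof cases
      case 1
      then have "1 \<le> b \<omega> * ennreal (1 / (3 * c))"
        using c by (intro scale) auto
      then show ?thesis
        by (rule order_trans) simp
    next
      case 2
      have "{y. (y, \<omega>) \<in> U} = UNIV - {y. (y, \<omega>) \<in> S}"
        using \<omega> by (auto simp: U_def space_pair_measure)
      then have "measure_pmf.prob \<mu> {y. (y, \<omega>) \<in> U} = 1 - measure_pmf.prob \<mu> {y. (y, \<omega>) \<in> S}"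
        using measure_pmf.prob_compl[of "{y. (y, \<omega>) \<in> S}" \<mu>] by simp
      then have "ennreal (3 * \<delta>) \<le> a \<omega>"
        using 2 by (simp add: a_def measure_pmf.emeasure_eq_measure ennreal_leI)
      then have "1 \<le> a \<omega> * ennreal (1 / (3 * \<delta>))"
        using \<delta> by (intro scale) auto
      then show ?thesis
        by (rule order_trans) simp
    qed
  qed
  have "1 = (\<integral>\<^sup>+ \<omega>. 1 \<partial>M)"
    by (simp add: M.emeasure_space_1)
  also have "\<dots> \<le> (\<integral>\<^sup>+ \<omega>. a \<omega> * ennreal (1 / (3 * \<delta>)) + b \<omega> * ennreal (1 / (3 * c)) \<partial>M)"
    by (intro nn_integral_mono large)
  also have "\<dots> = integral\<^sup>N M a * ennreal (1 / (3 * \<delta>)) + integral\<^sup>N M b * ennreal (1 / (3 * c))"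
    using a_meas b_meas by (simp add: nn_integral_add nn_integral_multc)
  also have "\<dots> \<le> ennreal \<delta> * ennreal (1 / (3 * \<delta>)) + ennreal c * ennreal (1 / (3 * c))"
    by (intro add_mono mult_right_mono a_int b_int) auto
  also have "\<dots> = ennreal (2 / 3)"
    using c \<delta> by (simp flip: ennreal_mult ennreal_plus)
  finally show False
    by simp
qed

text \<open>A union bound over the complements. The witness is taken from the support so that both
  endpoints of the path lie in the cube.\<close>

lemma prob_bounds_imp_witness:
  fixes \<Delta> \<epsilon> :: real
  assumes fin: "finite I"
    and A: "measure_pmf.prob P A \<ge> 1 - \<Delta>"
    and B: "\<And>t. t \<in> I \<Longrightarrow> measure_pmf.prob P (B t) \<ge> 1 - \<epsilon>"
    and C: "measure_pmf.prob P C > \<Delta> + card I * \<epsilon>"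
  shows "\<exists>z\<in>set_pmf P. z \<in> A \<and> z \<in> C \<and> (\<forall>t\<in>I. z \<in> B t)"
proof (rule ccontr)
  assume none: "\<not> ?thesis"
  let ?p = "measure_pmf.prob P"
  have compl: "?p (- X) = 1 - ?p X" for X
    using measure_pmf.prob_compl[of X P] by (simp add: Compl_eq_Diff_UNIV)
  have "?p C = ?p (C \<inter> set_pmf P)"
    by (simp add: measure_Int_set_pmf)
  also have "\<dots> \<le> ?p (- A \<union> (\<Union>t\<in>I. - B t))"
    using none by (intro measure_pmf.finite_measure_mono) auto
  also have "\<dots> \<le> ?p (- A) + ?p (\<Union>t\<in>I. - B t)"
    by (rule measure_Un_le) auto
  also have "\<dots> \<le> ?p (- A) + (\<Sum>t\<in>I. ?p (- B t))"
    using fin by (intro add_left_mono measure_pmf.finite_measure_subadditive_finite) auto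
  also have "\<dots> \<le> \<Delta> + (\<Sum>t\<in>I. \<epsilon>)"
    using A B by (intro add_mono sum_mono) (auto simp: compl algebra_simps)
  finally show False
    using C by simp
qed

section \<open>Combining stability, success along the path and the overlap gap\<close>

theorem theorem4p5:
  fixes n k D :: nat and d \<nu>1 \<nu>2 \<delta> \<gamma> \<Delta> \<eta> :: real
    and e :: "nat \<Rightarrow> nat set"
  assumes "edge_order n e"
    and "0 < d" and "d \<le> real n / 2"
    and "0 \<le> \<nu>1" and "\<nu>1 < \<nu>2" and "\<nu>2 \<le> 1"
    and "0 \<le> \<delta>" and "\<delta> \<le> 1" and "\<gamma> \<ge> 1" and "\<Delta> \<ge> 0"
    and "\<nu>2 * real n \<le> real k"
    and "measure_pmf.prob (pair_pmf (er_graph n (d / real n)) (er_graph n (d / real n)))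
           {(Y, Y'). overlap_gap (cube n) (overlap n) (real k) \<nu>1 \<nu>2 (path_family n e Y Y') \<and>
                     separated_above (cube n) (overlap n) \<nu>1 (real k)
                       (indep_obj n e Y) (indep_obj n e Y')} \<ge> 1 - \<Delta>"
    and "\<Delta> + 3 * \<delta> * (real (n choose 2) + 1) <
           exp (- (96 * \<gamma> * real D * real k * ln (real n / d) / ((\<nu>2 - \<nu>1)\<^sup>2 * real n)))"
    and "0 < \<eta>" and "\<eta> \<le> (\<nu>2 - \<nu>1)\<^sup>2 / 4"
  shows "\<not> (\<exists>(M :: 'w measure) f. random_poly n D M f \<and> optimizes n e d k \<delta> \<gamma> \<eta> M f)"
proof
  assume "\<exists>(M :: 'w measure) f. random_poly n D M f \<and> optimizes n e d k \<delta> \<gamma> \<eta> M f"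
  then obtain M :: "'w measure" and f
    where rp: "random_poly n D M f" and opt: "optimizes n e d k \<delta> \<gamma> \<eta> M f"
    by blast
  define m where "m = n choose 2"
  define p where "p = d / real n"
  let ?\<mu> = "random_bits m p"
  let ?exp = "exp (- (96 * \<gamma> * real D * real k * ln (real n / d) / ((\<nu>2 - \<nu>1)\<^sup>2 * real n)))"
  have er: "er_graph n (d / real n) = ?\<mu>"
    by (simp add: er_graph_def random_bits_def m_def p_def)
  have n: "0 < n" and p: "0 < p" "p \<le> 1/2"
    using \<open>0 < d\<close> \<open>d \<le> real n / 2\<close> by (auto simp: p_def field_simps intro: gr0I)
  have k: "0 < k"
  proof -
    have "0 < \<nu>2 * real n"
      using n assms(4,5) by simp
    also note \<open>\<nu>2 * real n \<le> real k\<close>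
    finally show ?thesis by simp
  qed
  have exp_le_1: "?exp \<le> 1"
  proof -
    have "1 \<le> real n / d"
      using \<open>0 < d\<close> \<open>d \<le> real n / 2\<close> by (simp add: field_simps)
    then have "0 \<le> 96 * \<gamma> * real D * real k * ln (real n / d) / ((\<nu>2 - \<nu>1)\<^sup>2 * real n)"
      using \<open>\<gamma> \<ge> 1\<close> by (intro divide_nonneg_nonneg mult_nonneg_nonneg) auto
    then show ?thesis by simp
  qed
  \<comment> \<open>Markov's inequality below needs a positive failure probability, while \<open>\<delta>\<close> may be 0.\<close>
  obtain \<delta>' where \<delta>': "\<delta> < \<delta>'" "\<Delta> + 3 * \<delta>' * (real m + 1) < ?exp"
  proof -
    have "\<delta> < (?exp - \<Delta>) / (3 * (real m + 1))"
      using assms(13) by (simp add: m_def field_simps)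
    then obtain s where "\<delta> < s" "s < (?exp - \<Delta>) / (3 * (real m + 1))"
      using dense by blast
    then show thesis
      by (intro that[of s]) (simp_all add: field_simps)
  qed
  have "\<delta> < 1"
  proof -
    have "3 * \<delta> * 1 \<le> 3 * \<delta> * (real m + 1)"
      using \<open>0 \<le> \<delta>\<close> by (intro mult_left_mono) auto
    then show ?thesis
      using assms(13) \<open>\<Delta> \<ge> 0\<close> exp_le_1 unfolding m_def[symmetric] by linarith
  qed
  define P where "P = measure_pmf ?\<mu> \<Otimes>\<^sub>M M"
  define S where "S = {(Y, \<omega>) \<in> space P. card (rounding n e \<eta> Y (f Y \<omega>)) \<ge> k}"
  define F where "F = (\<lambda>(Y, \<omega>). ennreal (\<Sum>i<n. (f Y \<omega> i)\<^sup>2))"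
  have M: "prob_space M"
    and deg: "\<And>i \<omega>. i < n \<Longrightarrow> \<omega> \<in> space M \<Longrightarrow> poly_deg_le m D (\<lambda>y. f y \<omega> i)"
    and meas: "\<And>i. i < n \<Longrightarrow> (\<lambda>(y, \<omega>). f y \<omega> i) \<in> borel_measurable (count_space UNIV \<Otimes>\<^sub>M M)"
    using rp by (auto simp: random_poly_def m_def)
  have F_int: "integral\<^sup>N P F \<le> ennreal (\<gamma> * real k)" and S_prob: "measure P S \<ge> 1 - \<delta>"
    using opt unfolding optimizes_def er Let_def P_def F_def S_def by auto
  have "sets P = sets (count_space UNIV \<Otimes>\<^sub>M M)"
    unfolding P_def by (intro sets_pair_measure_cong) auto
  then have [measurable]: "(\<lambda>z. f (fst z) (snd z) i) \<in> borel_measurable P" if "i < n" for i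
    using meas[OF that] by (simp add: case_prod_unfold cong: measurable_cong_sets)
  have F_meas: "F \<in> borel_measurable P"
    unfolding F_def case_prod_unfold by measurable
  \<comment> \<open>\<open>measure\<close> vanishes on non-measurable sets, and \<open>1 - \<delta>\<close> is positive.\<close>
  have S_sets: "S \<in> sets P"
    using S_prob \<open>\<delta> < 1\<close> measure_notin_sets[of S P] by fastforce
  obtain \<omega> where \<omega>: "\<omega> \<in> space M"
    and energy: "(\<integral>\<^sup>+ y. F (y, \<omega>) \<partial>measure_pmf ?\<mu>) \<le> ennreal (3 * (\<gamma> * real k))"
    and good: "measure_pmf.prob ?\<mu> {y. (y, \<omega>) \<in> S} \<ge> 1 - 3 * \<delta>'"
  proof -
    have "\<exists>\<omega>\<in>space M. (\<integral>\<^sup>+ y. F (y, \<omega>) \<partial>measure_pmf ?\<mu>) \<le> ennreal (3 * (\<gamma> * real k)) \<and>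
      measure_pmf.prob ?\<mu> {y. (y, \<omega>) \<in> S} \<ge> 1 - 3 * \<delta>'"
      using M F_meas F_int S_sets S_prob \<delta>' \<open>0 \<le> \<delta>\<close> \<open>\<gamma> \<ge> 1\<close> k
      unfolding P_def by (intro exists_good_sample) auto
    then show thesis using that by blast
  qed
  define g where "g = (\<lambda>Y. f Y \<omega>)"
  have "measure_pmf.expectation ?\<mu> (\<lambda>Y. \<Sum>i<n. (g Y i)\<^sup>2) \<le> 3 * \<gamma> * k"
  proof -
    have "(\<integral>\<^sup>+ y. F (y, \<omega>) \<partial>measure_pmf ?\<mu>) =
        ennreal (measure_pmf.expectation ?\<mu> (\<lambda>Y. \<Sum>i<n. (g Y i)\<^sup>2))"
      unfolding F_def g_def by (simp add: nn_integral_eq_integral sum_nonneg)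
    then show ?thesis
      using energy \<open>\<gamma> \<ge> 1\<close> by (simp add: ennreal_le_iff)
  qed
  \<comment> \<open>Energy \<open>3 * \<gamma> * k\<close> comes from the choice of
    \<open>\<omega>\<close>, and the jump threshold is the one of
    \<open>no_stable_rounding_along_gapped_path\<close>. The constant 96 is 4 times 3 times
    8.\<close>
  then have "exp (- (4 * real D * (3 * \<gamma> * k) / ((\<nu>2 - \<nu>1)\<^sup>2 * n / 8) * ln (1 / p)))
    \<le> measure_pmf.prob (pair_pmf ?\<mu> ?\<mu>) {(Y, Y'). \<forall>j<m.
        (\<Sum>i<n. (g (path_point Y Y' j) i - g (path_point Y Y' (Suc j)) i)\<^sup>2) < (\<nu>2 - \<nu>1)\<^sup>2 * n / 8}"
    using p n deg[OF _ \<omega>] \<open>\<nu>1 < \<nu>2\<close> by (intro low_degree_stable_on_path) (auto simp: g_def)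
  moreover have "4 * real D * (3 * \<gamma> * k) / ((\<nu>2 - \<nu>1)\<^sup>2 * n / 8) * ln (1 / p) =
      96 * \<gamma> * real D * real k * ln (real n / d) / ((\<nu>2 - \<nu>1)\<^sup>2 * real n)"
    by (simp add: p_def)
  ultimately have "?exp \<le> measure_pmf.prob (pair_pmf ?\<mu> ?\<mu>) {(Y, Y'). \<forall>j<m.
        (\<Sum>i<n. (g (path_point Y Y' j) i - g (path_point Y Y' (Suc j)) i)\<^sup>2) < (\<nu>2 - \<nu>1)\<^sup>2 * n / 8}"
    by (simp only:)
  \<comment> \<open>The path has \<open>m + 1\<close> points, both ends included, and each may fail
    with probability up to \<open>3 * \<delta>'\<close>.\<close>
  moreover have "\<Delta> + card {..m} * (3 * \<delta>') < ?exp"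
    using \<delta>'(2) by (simp add: algebra_simps)
  ultimately have stable: "\<Delta> + card {..m} * (3 * \<delta>') <
      measure_pmf.prob (pair_pmf ?\<mu> ?\<mu>) {(Y, Y'). \<forall>j<m.
        (\<Sum>i<n. (g (path_point Y Y' j) i - g (path_point Y Y' (Suc j)) i)\<^sup>2) < (\<nu>2 - \<nu>1)\<^sup>2 * n / 8}"
    by linarith
  have large: "measure_pmf.prob (pair_pmf ?\<mu> ?\<mu>)
      {(Y, Y'). k \<le> card (rounding n e \<eta> (path_point Y Y' t) (g (path_point Y Y' t)))} \<ge> 1 - 3 * \<delta>'"
    if "t \<in> {..m}" for t
  proof -
    \<comment> \<open>Success of the fixed polynomial is known for one random graph; it transfers to
      time \<open>t\<close> because the path point has the same law.\<close>
    have "measure_pmf.prob ?\<mu> {y. (y, \<omega>) \<in> S} =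
        measure_pmf.prob (map_pmf (\<lambda>(Y, Y'). path_point Y Y' t) (pair_pmf ?\<mu> ?\<mu>)) {y. (y, \<omega>) \<in> S}"
      using that by (simp only: map_path_point atMost_iff)
    also have "\<dots> = measure_pmf.prob (pair_pmf ?\<mu> ?\<mu>)
      {(Y, Y'). k \<le> card (rounding n e \<eta> (path_point Y Y' t) (g (path_point Y Y' t)))}"
      using \<omega> by (simp add: S_def P_def g_def space_pair_measure vimage_def case_prod_unfold)
    finally show ?thesis
      using good by simp
  qed
  obtain Y Y' where Y: "(Y, Y') \<in> set_pmf (pair_pmf ?\<mu> ?\<mu>)"
    and gap: "overlap_gap (cube n) (overlap n) (real k) \<nu>1 \<nu>2 (path_family n e Y Y')"
      "separated_above (cube n) (overlap n) \<nu>1 (real k) (indep_obj n e Y) (indep_obj n e Y')"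
    and "\<forall>j<m. (\<Sum>i<n. (g (path_point Y Y' j) i - g (path_point Y Y' (Suc j)) i)\<^sup>2) < (\<nu>2 - \<nu>1)\<^sup>2 * n / 8"
    and "\<forall>t\<in>{..m}. k \<le> card (rounding n e \<eta> (path_point Y Y' t) (g (path_point Y Y' t)))"
    using prob_bounds_imp_witness[where B = "\<lambda>t. {(Y, Y').
          k \<le> card (rounding n e \<eta> (path_point Y Y' t) (g (path_point Y Y' t)))}",
        OF finite_atMost assms(12)[unfolded er] large stable] by auto
  moreover have "Y \<in> cube m" "Y' \<in> cube m"
    using Y set_random_bits by auto
  ultimately show False
    using assms n k
    by (intro no_stable_rounding_along_gapped_path[of \<nu>1 \<nu>2 n k \<eta> Y Y' e
          "\<lambda>t. g (path_point Y Y' t)"])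
      (auto simp: m_def)
qed

end
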